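(* Let $\Omega\subset\mathbb{R}^2$ be open and let $F\in C^2(\Omega)$. Fix $(t,x)\in\Omega$. All quantities involving $F$ below are evaluated at $(t,x)$. Consider the problem $$\inf_{\sigma>0}|\mathcal{D}_\sigma|.\qquad(\ast)$$ (G1) If $F\mathcal{L}_FF=0$, then every $\sigma>0$ is a minimizer of $(\ast)$ and $\min_{\sigma>0}|\mathcal{D}_\sigma|=|\mathcal{L}_F^2F|$. These minimizers are optimal if and only if $\mathcal{L}_F^2F=0$. (G2) Suppose that $F\mathcal{L}_FF\ne0$ and $F\mathcal{L}_F^2F\le0$. Then $(\ast)$ has no minimizer and $$\inf_{\sigma>0}|\mathcal{D}_\sigma|=\lim_{\sigma\to\infty}|\mathcal{D}_\sigma|=|\mathcal{L}_F^2F|.$$ (G3) Suppose that $F\mathcal{L}_FF\ne0$, $F\mathcal{L}_F^2F>0$, and $3(\mathcal{L}_FF)^2>F\mathcal{L}_F^2F$. Then $(\ast)$ has a unique optimal minimizer $\sigma^\ast=\sigma^{\ast}(t,x)>0$, which is given by $$\sigma^\ast=\left(\frac{3F(\mathcal{L}_FF)^2}{\mathcal{L}_F^2F}-F^2\right)^{1/2},$$ and for which $\min_{\sigma>0}|\mathcal{D}_\sigma|=|\mathcal{D}_{\sigma^\ast}|=0$. (G4) Suppose that $F\mathcal{L}_FF\ne0$, $F\mathcal{L}_F^2F>0$, and $3(\mathcal{L}_FF)^2\le F\mathcal{L}_F^2F$. Then $(\ast)$ has no minimizer and $$\inf_{\sigma>0}|\mathcal{D}_\sigma|=\lim_{\s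igma\searrow0}|\mathcal{D}_\sigma|=\left|\mathcal{L}_F^2F-\frac{3(\mathcal{L}_FF)^2}{F}\right|.$$
   Context: For $G\in C^1(\Omega)$, $\mathcal{L}_FG:=G_t+FG_x$, where $(t,x)$ are the coordinates in $\Omega$; for $G\in C^2(\Omega)$, $\mathcal{L}_F^2G:=\mathcal{L}_F(\mathcal{L}_FG)$. For $\sigma>0$ the curvature-variation defect field is $$\mathcal{D}_\sigma(t,x):=\mathcal{L}_F^2F(t,x)-\frac{3F(t,x)\bigl(\mathcal{L}_FF(t,x)\bigr)^2}{\sigma^2+F(t,x)^2}.$$ A minimizer of $(\ast)$ is a $\sigma>0$ at which the infimum is attained; a minimizer $\sigma>0$ is called optimal if $\mathcal{D}_\sigma(t,x)=0$. *)

theory Defs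
  imports "HOL-Analysis.Analysis"
begin

definition partial_t :: "(real \<times> real \<Rightarrow> real) \<Rightarrow> real \<times> real \<Rightarrow> real" where
  "partial_t G = (\<lambda>(t, x). deriv (\<lambda>s. G (s, x)) t)"

definition partial_x :: "(real \<times> real \<Rightarrow> real) \<Rightarrow> real \<times> real \<Rightarrow> real" where
  "partial_x G = (\<lambda>(t, x). deriv (\<lambda>y. G (t, y)) x)"

definition has_partials_on :: "(real \<times> real \<Rightarrow> real) \<Rightarrow> (real \<times> real) set \<Rightarrow> bool" where
  "has_partials_on G \<Omega> \<longleftrightarrow>
     (\<forall>(t, x)\<in>\<Omega>. (\<lambda>s. G (s, x)) field_differentiable (at t) \<and>
                 (\<lambda>y. G (t, y)) field_differentiable (at x))"

text \<open>
  \<open>Ck_on k \<Omega> G\<close> says that \<open>G\<close> is of class \<open>C\<^sup>k\<close> on \<open>\<Omega>\<close>: all partial derivatives of order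
  at most \<open>k\<close> exist and are continuous on \<open>\<Omega>\<close>. It is meant for open \<open>\<Omega>\<close>, in which case it
  depends only on the restriction of the total function \<open>G\<close> to \<open>\<Omega>\<close>.
\<close>

fun Ck_on :: "nat \<Rightarrow> (real \<times> real) set \<Rightarrow> (real \<times> real \<Rightarrow> real) \<Rightarrow> bool" where
  "Ck_on 0 \<Omega> G \<longleftrightarrow> continuous_on \<Omega> G"
| "Ck_on (Suc k) \<Omega> G \<longleftrightarrow>
     continuous_on \<Omega> G \<and> has_partials_on G \<Omega> \<and>
     Ck_on k \<Omega> (partial_t G) \<and> Ck_on k \<Omega> (partial_x G)"

definition lie :: "(real \<times> real \<Rightarrow> real) \<Rightarrow> (real \<times> real \<Rightarrow> real) \<Rightarrow> real \<times> real \<Rightarrow> real" where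
  "lie F G = (\<lambda>p. partial_t G p + F p * partial_x G p)"

definition defect :: "(real \<times> real \<Rightarrow> real) \<Rightarrow> real \<Rightarrow> real \<times> real \<Rightarrow> real" where
  "defect F \<sigma> p = lie F (lie F F) p - 3 * F p * (lie F F p)\<^sup>2 / (\<sigma>\<^sup>2 + (F p)\<^sup>2)"

text \<open>
  The real-valued \<open>Inf\<close> below is a genuine infimum, since the set of values
  \<open>\<bar>defect F \<sigma> p\<bar>\<close> with \<open>\<sigma> > 0\<close> is nonempty and bounded below by \<open>0\<close>.
\<close>

definition inf_defect :: "(real \<times> real \<Rightarrow> real) \<Rightarrow> real \<times> real \<Rightarrow> real" where
  "inf_defect F p = (INF \<sigma>\<in>{0<..}. \<bar>defect F \<sigma> p\<bar>)"

definition is_minimizer :: "(real \<times> real \<Rightarrow> real) \<Rightarrow> real \<times> real \<Rightarrow> real \<Rightarrow> bool" where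
  "is_minimizer F p \<sigma> \<longleftrightarrow> \<sigma> > 0 \<and> \<bar>defect F \<sigma> p\<bar> = inf_defect F p"

definition is_optimal_minimizer :: "(real \<times> real \<Rightarrow> real) \<Rightarrow> real \<times> real \<Rightarrow> real \<Rightarrow> bool" where
  "is_optimal_minimizer F p \<sigma> \<longleftrightarrow> is_minimizer F p \<sigma> \<and> defect F \<sigma> p = 0"

text \<open>The infimum is attained and equals \<open>m\<close>, i.e.\ the minimum exists and is \<open>m\<close>.\<close>

definition has_min_defect :: "(real \<times> real \<Rightarrow> real) \<Rightarrow> real \<times> real \<Rightarrow> real \<Rightarrow> bool" where
  "has_min_defect F p m \<longleftrightarrow> (\<exists>\<sigma>. is_minimizer F p \<sigma>) \<and> inf_defect F p = m"

end

theory Submission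
  imports Defs
begin

text \<open>
  For \<open>f = F p \<noteq> 0\<close> put \<open>L = lie F F p\<close>, \<open>u = f * lie F (lie F F) p\<close>, \<open>w = 3 * L\<^sup>2\<close> and
  \<open>r = f\<^sup>2 / (\<sigma>\<^sup>2 + f\<^sup>2)\<close>. Then \<open>\<bar>f\<bar> * \<bar>defect F \<sigma> p\<bar> = \<bar>u - w * r\<bar>\<close>, where \<open>r\<close> runs bijectively
  through the open interval \<open>(0, 1)\<close>, with \<open>r \<rightarrow> 0\<close> as \<open>\<sigma> \<rightarrow> \<infinity>\<close> and \<open>r \<rightarrow> 1\<close> as \<open>\<sigma> \<rightarrow> 0\<close>. If \<open>w > 0\<close>,
  the affine function \<open>u - w * r\<close> has a zero in the interval iff \<open>0 < u < w\<close>; otherwise its absolute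
  value stays strictly above its value at one of the two excluded end points.
\<close>

text \<open>Values of \<open>h\<close> along \<open>A\<close> lie above the infimum and tend to
  \<open>m\<close>, so the infimum is at most \<open>m\<close>; the lower bound gives the converse.
  An arbitrary filter lets the same argument serve \<open>at_top\<close> and
  \<open>at_right 0\<close>.\<close>

lemma cINF_eq_limit:
  fixes h :: "'a \<Rightarrow> real"
  assumes "(h \<longlongrightarrow> m) A" "A \<noteq> bot" "eventually (\<lambda>x. x \<in> S) A" "\<And>x. x \<in> S \<Longrightarrow> m \<le> h x"
  shows "(INF x\<in>S. h x) = m"
proof (rule antisym)
  have bdd: "bdd_below (h ` S)"
    using assms(4) by (rule bdd_belowI2)
  have "eventually (\<lambda>x. (INF x\<in>S. h x) \<le> h x) A"
    using assms(3) by eventually_elim (rule cINF_lower[OF bdd])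
  then show "(INF x\<in>S. h x) \<le> m"
    by (rule tendsto_lowerbound[OF assms(1) _ assms(2)])
  have "S \<noteq> {}"
    using assms(2,3) by (auto simp: trivial_limit_def)
  then show "m \<le> (INF x\<in>S. h x)"
    using assms(4) by (rule cINF_greatest)
qed

text \<open>Common core of the two cases without minimizer: the infimum is approached only at an
  excluded end of the half-line, and strictness rules out attainment.\<close>

lemma unattained_inf_defect:
  assumes "((\<lambda>\<sigma>. \<bar>defect F \<sigma> p\<bar>) \<longlongrightarrow> m) A" "A \<noteq> bot" "eventually (\<lambda>\<sigma>. \<sigma> > 0) A"
    and less: "\<And>\<sigma>. \<sigma> > 0 \<Longrightarrow> m < \<bar>defect F \<sigma> p\<bar>"
  shows "inf_defect F p = m" "\<nexists>\<sigma>. is_minimizer F p \<sigma>"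
proof -
  show "inf_defect F p = m"
    unfolding inf_defect_def using assms by (intro cINF_eq_limit) (auto intro: less_imp_le)
  then show "\<nexists>\<sigma>. is_minimizer F p \<sigma>"
    using less by (force simp: is_minimizer_def)
qed

text \<open>Absolute values are bounded below by 0, so a positive zero of the defect is
  automatically a minimizer. Optimality thus reduces to solving an equation in
  \<open>\<sigma>\<close>.\<close>

lemma is_optimal_minimizer_iff:
  "is_optimal_minimizer F p \<sigma> \<longleftrightarrow> \<sigma> > 0 \<and> defect F \<sigma> p = 0"
proof -
  have "inf_defect F p = 0" if "\<sigma> > 0" "defect F \<sigma> p = 0"
    unfolding inf_defect_def
    using that by (intro cInf_eq_minimum) (auto simp: image_iff intro!: bexI[of _ \<sigma>])
  then show ?thesis
    by (auto simp: is_optimal_minimizer_def is_minimizer_def)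
qed

text \<open>Either vanishing factor kills the numerator of the only term that depends on
  \<open>\<sigma>\<close>.\<close>

lemma defect_degenerate:
  assumes "F p * lie F F p = 0"
  shows "defect F \<sigma> p = lie F (lie F F) p"
  using assms by (auto simp: defect_def)

lemma inf_defect_degenerate:
  assumes "F p * lie F F p = 0"
  shows "inf_defect F p = \<bar>lie F (lie F F) p\<bar>"
  unfolding inf_defect_def defect_degenerate[OF assms]
  by (rule cINF_const) simp

lemma abs_mult_defect:
  "\<bar>F p\<bar> * \<bar>defect F \<sigma> p\<bar> =
     \<bar>F p * lie F (lie F F) p - 3 * (lie F F p)\<^sup>2 * ((F p)\<^sup>2 / (\<sigma>\<^sup>2 + (F p)\<^sup>2))\<bar>"
  unfolding abs_mult[symmetric] defect_def by (simp add: algebra_simps power2_eq_square)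

lemma ratio_bounds:
  fixes f \<sigma> :: real
  assumes "f \<noteq> 0" "\<sigma> > 0"
  shows "0 < f\<^sup>2 / (\<sigma>\<^sup>2 + f\<^sup>2)" "f\<^sup>2 / (\<sigma>\<^sup>2 + f\<^sup>2) < 1"
  using assms by (simp_all add: add_pos_pos)

lemma less_abs_defect_far:
  assumes "F p * lie F F p \<noteq> 0" "F p * lie F (lie F F) p \<le> 0" "\<sigma> > 0"
  shows "\<bar>lie F (lie F F) p\<bar> < \<bar>defect F \<sigma> p\<bar>"
proof -
  have nz: "F p \<noteq> 0" "lie F F p \<noteq> 0"
    using assms(1) by auto
  have "0 < 3 * (lie F F p)\<^sup>2 * ((F p)\<^sup>2 / (\<sigma>\<^sup>2 + (F p)\<^sup>2))"
    using nz by (intro mult_pos_pos ratio_bounds assms(3)) auto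
  \<comment> \<open>Subtracting a positive quantity from a nonpositive number moves it further from
    0.\<close>
  then have "\<bar>F p * lie F (lie F F) p\<bar> < \<bar>F p\<bar> * \<bar>defect F \<sigma> p\<bar>"
    unfolding abs_mult_defect using assms(2) by linarith
  then show ?thesis
    using nz by (simp add: abs_mult)
qed

lemma less_abs_defect_near:
  assumes "F p * lie F F p \<noteq> 0" "3 * (lie F F p)\<^sup>2 \<le> F p * lie F (lie F F) p" "\<sigma> > 0"
  shows "\<bar>lie F (lie F F) p - 3 * (lie F F p)\<^sup>2 / F p\<bar> < \<bar>defect F \<sigma> p\<bar>"
proof -
  have nz: "F p \<noteq> 0" "lie F F p \<noteq> 0"
    using assms(1) by auto
  have "3 * (lie F F p)\<^sup>2 * ((F p)\<^sup>2 / (\<sigma>\<^sup>2 + (F p)\<^sup>2)) < 3 * (lie F F p)\<^sup>2 * 1"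
    using nz by (intro mult_strict_left_mono ratio_bounds assms(3)) auto
  then have "\<bar>F p * lie F (lie F F) p - 3 * (lie F F p)\<^sup>2\<bar> < \<bar>F p\<bar> * \<bar>defect F \<sigma> p\<bar>"
    unfolding abs_mult_defect using assms(2) by linarith
  moreover have "F p * lie F (lie F F) p - 3 * (lie F F p)\<^sup>2 =
      F p * (lie F (lie F F) p - 3 * (lie F F p)\<^sup>2 / F p)"
    using nz by (simp add: field_simps)
  ultimately show ?thesis
    using nz by (simp add: abs_mult)
qed

lemma tendsto_defect_at_top: "((\<lambda>\<sigma>. defect F \<sigma> p) \<longlongrightarrow> lie F (lie F F) p) at_top"
proof -
  have "filterlim (\<lambda>\<sigma>::real. \<sigma>\<^sup>2 + (F p)\<^sup>2) at_top at_top"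
    \<comment> \<open>The denominator dominates the square of \<open>\<sigma>\<close>, which tends
      to infinity.\<close>
    by (rule filterlim_at_top_mono[OF filterlim_pow_at_top[of 2, OF _ filterlim_ident]]) auto
  from filterlim_at_top_imp_at_infinity[OF this]
  have "((\<lambda>\<sigma>. lie F (lie F F) p - 3 * F p * (lie F F p)\<^sup>2 / (\<sigma>\<^sup>2 + (F p)\<^sup>2)) \<longlongrightarrow>
      lie F (lie F F) p - 0) at_top"
    by (intro tendsto_diff tendsto_divide_0[OF tendsto_const] tendsto_const)
  then show ?thesis
    by (simp add: defect_def)
qed

lemma tendsto_defect_at_right_0:
  assumes "F p \<noteq> 0"
  shows "((\<lambda>\<sigma>. defect F \<sigma> p) \<longlongrightarrow> lie F (lie F F) p - 3 * (lie F F p)\<^sup>2 / F p) (at_right 0)"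
proof -
  \<comment> \<open>Since \<open>F p \<noteq> 0\<close>, the denominator is nonzero even at
    \<open>\<sigma> = 0\<close>, so the limit is obtained by substitution.\<close>
  have "((\<lambda>\<sigma>. defect F \<sigma> p) \<longlongrightarrow>
      lie F (lie F F) p - 3 * F p * (lie F F p)\<^sup>2 / (0\<^sup>2 + (F p)\<^sup>2)) (at_right 0)"
    unfolding defect_def using assms by (intro tendsto_intros) auto
  then show ?thesis
    using assms by (simp add: power2_eq_square)
qed

lemma defect_eq_0_iff:
  assumes "F p \<noteq> 0" "lie F (lie F F) p \<noteq> 0"
  shows "defect F \<sigma> p = 0 \<longleftrightarrow>
    \<sigma>\<^sup>2 = 3 * F p * (lie F F p)\<^sup>2 / lie F (lie F F) p - (F p)\<^sup>2"
proof -
  have "\<sigma>\<^sup>2 + (F p)\<^sup>2 \<noteq> 0"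
    using assms(1) by (simp add: sum_power2_eq_zero_iff)
  then show ?thesis
    using assms by (auto simp: defect_def field_simps)
qed

lemma optimal_radicand_pos:
  fixes f L L2 :: real
  assumes "f * L2 > 0" "3 * L\<^sup>2 > f * L2"
  shows "3 * f * L\<^sup>2 / L2 - f\<^sup>2 > 0"
proof -
  have nz: "f \<noteq> 0" "L2 \<noteq> 0"
    using assms(1) by auto
  \<comment> \<open>Expanding the fraction by \<open>f\<close> exhibits the radicand as a quotient
    whose factors are positive by the two hypotheses.\<close>
  then have "3 * f * L\<^sup>2 / L2 - f\<^sup>2 = f\<^sup>2 * (3 * L\<^sup>2 - f * L2) / (f * L2)"
    by (simp add: field_simps power2_eq_square)
  then show ?thesis
    using assms nz by simp
qed

lemma is_optimal_minimizer_iff_sqrt: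
  assumes "F p * lie F (lie F F) p > 0" "3 * (lie F F p)\<^sup>2 > F p * lie F (lie F F) p"
  shows "is_optimal_minimizer F p \<sigma> \<longleftrightarrow>
    \<sigma> = sqrt (3 * F p * (lie F F p)\<^sup>2 / lie F (lie F F) p - (F p)\<^sup>2)"
proof -
  have "F p \<noteq> 0" "lie F (lie F F) p \<noteq> 0"
    using assms(1) by auto
  then show ?thesis
    \<comment> \<open>A positive radicand has exactly one positive square root, which gives
      existence and uniqueness together.\<close>
    using optimal_radicand_pos[OF assms]
    by (auto simp: is_optimal_minimizer_iff defect_eq_0_iff intro!: real_sqrt_unique[symmetric])
qed

theorem theorem5p2:
  fixes \<Omega> :: "(real \<times> real) set" and F :: "real \<times> real \<Rightarrow> real" and t x :: real
  assumes "open \<Omega>" and "Ck_on 2 \<Omega> F" and "(t, x) \<in> \<Omega>"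
  shows
    "let p = (t, x); f = F p; L = lie F F p; L2 = lie F (lie F F) p in
      (f * L = 0 \<longrightarrow>
        (\<forall>\<sigma>>0. is_minimizer F p \<sigma>) \<and>
        has_min_defect F p \<bar>L2\<bar> \<and>
        (\<forall>\<sigma>>0. is_optimal_minimizer F p \<sigma> \<longleftrightarrow> L2 = 0)) \<and>
      (f * L \<noteq> 0 \<and> f * L2 \<le> 0 \<longrightarrow>
        (\<nexists>\<sigma>. is_minimizer F p \<sigma>) \<and>
        inf_defect F p = \<bar>L2\<bar> \<and>
        ((\<lambda>\<sigma>. \<bar>defect F \<sigma> p\<bar>) \<longlongrightarrow> \<bar>L2\<bar>) at_top) \<and>
      (f * L \<noteq> 0 \<and> f * L2 > 0 \<and> 3 * L\<^sup>2 > f * L2 \<longrightarrow>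
        (\<exists>!\<sigma>. is_optimal_minimizer F p \<sigma>) \<and>
        (let \<sigma>s = sqrt (3 * f * L\<^sup>2 / L2 - f\<^sup>2) in
          \<sigma>s > 0 \<and> is_optimal_minimizer F p \<sigma>s \<and>
          has_min_defect F p \<bar>defect F \<sigma>s p\<bar> \<and> \<bar>defect F \<sigma>s p\<bar> = 0)) \<and>
      (f * L \<noteq> 0 \<and> f * L2 > 0 \<and> 3 * L\<^sup>2 \<le> f * L2 \<longrightarrow>
        (\<nexists>\<sigma>. is_minimizer F p \<sigma>) \<and>
        inf_defect F p = \<bar>L2 - 3 * L\<^sup>2 / f\<bar> \<and>
        ((\<lambda>\<sigma>. \<bar>defect F \<sigma> p\<bar>) \<longlongrightarrow> \<bar>L2 - 3 * L\<^sup>2 / f\<bar>) (at_right 0))"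
proof -
  define p where "p = (t, x)"
  define f where "f = F p"
  define L where "L = lie F F p"
  define L2 where "L2 = lie F (lie F F) p"
  note defs = f_def L_def L2_def
  have degenerate: "(\<forall>\<sigma>>0. is_minimizer F p \<sigma>) \<and> has_min_defect F p \<bar>L2\<bar> \<and>
      (\<forall>\<sigma>>0. is_optimal_minimizer F p \<sigma> \<longleftrightarrow> L2 = 0)" if "f * L = 0"
  proof -
    have *: "F p * lie F F p = 0"
      using that by (simp add: defs)
    have "\<forall>\<sigma>>0. is_minimizer F p \<sigma>"
      by (simp add: is_minimizer_def defect_degenerate[OF *] inf_defect_degenerate[OF *])
    moreover from this have "has_min_defect F p \<bar>L2\<bar>"
      unfolding has_min_defect_def inf_defect_degenerate[OF *] L2_def
      \<comment> \<open>The witness for attainment is \<open>\<sigma> = 1\<close>; any positive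
        number would do.\<close>
      using zero_less_one by blast
    ultimately show ?thesis
      by (simp add: is_optimal_minimizer_iff defect_degenerate[OF *] L2_def)
  qed
  have far: "(\<nexists>\<sigma>. is_minimizer F p \<sigma>) \<and> inf_defect F p = \<bar>L2\<bar> \<and>
      ((\<lambda>\<sigma>. \<bar>defect F \<sigma> p\<bar>) \<longlongrightarrow> \<bar>L2\<bar>) at_top" if "f * L \<noteq> 0" "f * L2 \<le> 0"
  proof -
    have lim: "((\<lambda>\<sigma>. \<bar>defect F \<sigma> p\<bar>) \<longlongrightarrow> \<bar>L2\<bar>) at_top"
      unfolding L2_def by (intro tendsto_rabs tendsto_defect_at_top)
    have less: "\<bar>L2\<bar> < \<bar>defect F \<sigma> p\<bar>" if "\<sigma> > 0" for \<sigma>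
      using less_abs_defect_far[of F p \<sigma>] \<open>f * L \<noteq> 0\<close> \<open>f * L2 \<le> 0\<close> that by (simp add: defs)
    from unattained_inf_defect[OF lim trivial_limit_at_top_linorder eventually_gt_at_top less] lim
    show ?thesis
      by blast
  qed
  have inner: "(\<exists>!\<sigma>. is_optimal_minimizer F p \<sigma>) \<and>
      (let \<sigma>s = sqrt (3 * f * L\<^sup>2 / L2 - f\<^sup>2) in
        \<sigma>s > 0 \<and> is_optimal_minimizer F p \<sigma>s \<and>
        has_min_defect F p \<bar>defect F \<sigma>s p\<bar> \<and> \<bar>defect F \<sigma>s p\<bar> = 0)"
    if "f * L2 > 0" "3 * L\<^sup>2 > f * L2"
  proof -
    define s where "s = sqrt (3 * f * L\<^sup>2 / L2 - f\<^sup>2)"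
    have iff: "is_optimal_minimizer F p \<sigma> \<longleftrightarrow> \<sigma> = s" for \<sigma>
      using is_optimal_minimizer_iff_sqrt[of F p \<sigma>] that by (simp add: s_def defs)
    then have opt: "is_optimal_minimizer F p s"
      by simp
    then have "s > 0" "defect F s p = 0" "has_min_defect F p \<bar>defect F s p\<bar>"
      by (auto simp: is_optimal_minimizer_def is_minimizer_def has_min_defect_def)
    then show ?thesis
      unfolding Let_def s_def[symmetric] using iff opt by simp
  qed
  have near: "(\<nexists>\<sigma>. is_minimizer F p \<sigma>) \<and> inf_defect F p = \<bar>L2 - 3 * L\<^sup>2 / f\<bar> \<and>
      ((\<lambda>\<sigma>. \<bar>defect F \<sigma> p\<bar>) \<longlongrightarrow> \<bar>L2 - 3 * L\<^sup>2 / f\<bar>) (at_right 0)"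
    if "f * L \<noteq> 0" "3 * L\<^sup>2 \<le> f * L2"
  proof -
    have lim: "((\<lambda>\<sigma>. \<bar>defect F \<sigma> p\<bar>) \<longlongrightarrow> \<bar>L2 - 3 * L\<^sup>2 / f\<bar>) (at_right 0)"
      unfolding defs using that(1) by (intro tendsto_rabs tendsto_defect_at_right_0) (auto simp: f_def)
    have less: "\<bar>L2 - 3 * L\<^sup>2 / f\<bar> < \<bar>defect F \<sigma> p\<bar>" if "\<sigma> > 0" for \<sigma>
      using less_abs_defect_near[of F p \<sigma>] \<open>f * L \<noteq> 0\<close> \<open>3 * L\<^sup>2 \<le> f * L2\<close> that by (simp add: defs)
    from unattained_inf_defect[OF lim trivial_limit_at_right_real eventually_at_right_less less] lim
    show ?thesis
      by blast
  qed
  show ?thesis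
    unfolding Let_def p_def[symmetric] defs[symmetric]
    using degenerate far inner[unfolded Let_def] near by blast
qed

end
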